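(* Let $k>3$ be an integer. Then \[\mathcal{L}_2S_k(2k)=\{n\geq 2k-1\mid n\equiv 0,1\pmod 4\},\] and for every $v>2k$ with $v(v-1)\equiv 0\pmod{2k}$, \[\mathcal{L}_2S_k(v)=\{n\geq v\mid n\equiv 0,1\pmod 4\}.\]
   Context: All graphs are finite and simple; $\Gamma\leq K$ means $\Gamma$ is a subgraph of $K$ (or is isomorphic to one, when $\Gamma$ is an abstract graph). $P_3$ is the path on $3$ vertices; $S_k$ is the star on $k+1$ vertices, i.e. the complete bipartite graph $K_{1,k}$. For a graph $K$ and $\Gamma\leq K$, a $(K,\Gamma)$-design is a set $\mathcal{B}$ of subgraphs of $K$, called blocks, each isomorphic to $\Gamma$, whose edge-sets partition $E(K)$. $K_n$ is the complete graph on a set of $n$ vertices (any $n$-element vertex set may be used); a $\Gamma$-design of order $n$ is a $(K_n,\Gamma)$-design. Given $\Gamma'\leq\Gamma$, a $(K,\Gamma)$-design $\mathcal{B}$ and a $(K',\Gamma')$-design $\mathcal{B}'$, a down-link from $\mathcal{B}$ to $\mathcal{B}'$ is a function $f:\mathcal{B}\to\mathcal{B}'$ such that $f(B)$ is a subgraph of $B$ for every $B\in\mathcal{B}$ (the vertex sets of $K$ and $K'$ need not coincide, and either may be the larger). Take $\Gamma'=P_3$. For $v$ such that a $(K_v,\Gamma)$-design exists, $\mathcal{L}_2\Gamma(v)$ is the set of all integers $n$ such that every $\Gamma$-design of order $v$ can be down-linked to a $P_3$-design of order $n$. A $(K_v,S_k)$-design exists if and only if $v\geq 2k$ and $v(v-1)\equiv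 0\pmod{2k}$. *)

theory Defs
  imports
    "HOL-Library.Disjoint_Sets"
    "HOL-Library.Infinite_Typeclass"
    "HOL-Number_Theory.Cong"
begin

record 'a sgraph =
  Verts :: "'a set"
  Edges :: "'a set set"

definition simple_graph :: "'a sgraph \<Rightarrow> bool" where
  "simple_graph G \<longleftrightarrow> finite (Verts G) \<and> (\<forall>e\<in>Edges G. e \<subseteq> Verts G \<and> card e = 2)"

definition subgraph :: "'a sgraph \<Rightarrow> 'a sgraph \<Rightarrow> bool" where
  "subgraph H G \<longleftrightarrow>
     simple_graph H \<and> simple_graph G \<and> Verts H \<subseteq> Verts G \<and> Edges H \<subseteq> Edges G"

definition isomorphic :: "'a sgraph \<Rightarrow> 'b sgraph \<Rightarrow> bool" where
  "isomorphic G H \<longleftrightarrow>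
     (\<exists>f. bij_betw f (Verts G) (Verts H) \<and> Edges H = (\<lambda>e. f ` e) ` Edges G)"

(* \<Gamma> \<le> K for an abstract graph \<Gamma>, possibly over another vertex type *)
definition embeds :: "'b sgraph \<Rightarrow> 'a sgraph \<Rightarrow> bool" where
  "embeds \<Gamma> K \<longleftrightarrow> (\<exists>H. subgraph H K \<and> isomorphic H \<Gamma>)"

definition complete_graph :: "'a set \<Rightarrow> 'a sgraph" where
  "complete_graph V = \<lparr>Verts = V, Edges = {e. e \<subseteq> V \<and> card e = 2}\<rparr>"

definition path_graph :: "nat \<Rightarrow> nat sgraph" where
  "path_graph n = \<lparr>Verts = {..<n}, Edges = {{i, Suc i} |i. Suc i < n}\<rparr>"

definition star_graph :: "nat \<Rightarrow> nat sgraph" where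
  "star_graph k = \<lparr>Verts = {0..k}, Edges = {{0, i} |i. i \<in> {1..k}}\<rparr>"

(* Injectivity of Edges makes this a partition indexed by the blocks themselves:
   distinct blocks have distinct, hence disjoint, edge sets. *)
definition graph_design :: "'a sgraph \<Rightarrow> 'b sgraph \<Rightarrow> 'a sgraph set \<Rightarrow> bool" where
  "graph_design K \<Gamma> \<B> \<longleftrightarrow>
     simple_graph K \<and> embeds \<Gamma> K \<and>
     (\<forall>B\<in>\<B>. subgraph B K \<and> isomorphic B \<Gamma>) \<and>
     inj_on Edges \<B> \<and> partition_on (Edges K) (Edges ` \<B>)"

definition design_of_order :: "nat \<Rightarrow> 'b sgraph \<Rightarrow> 'a sgraph set \<Rightarrow> bool" where
  "design_of_order n \<Gamma> \<B> \<longleftrightarrow>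
     (\<exists>V. finite V \<and> card V = n \<and> graph_design (complete_graph V) \<Gamma> \<B>)"

definition down_link ::
  "'a sgraph set \<Rightarrow> 'a sgraph set \<Rightarrow> ('a sgraph \<Rightarrow> 'a sgraph) \<Rightarrow> bool" where
  "down_link \<B> \<B>' f \<longleftrightarrow> (\<forall>B\<in>\<B>. f B \<in> \<B>' \<and> subgraph (f B) B)"

(* The set L_2 \<Gamma>(v). The type argument is the universe from which all vertices are
   drawn; it has to be infinite so that complete graphs of every order are available. *)
definition L2 :: "'a::infinite itself \<Rightarrow> 'b sgraph \<Rightarrow> nat \<Rightarrow> nat set" where
  "L2 _ \<Gamma> v =
     {n. \<forall>\<B> :: 'a sgraph set. design_of_order v \<Gamma> \<B> \<longrightarrow>
           (\<exists>\<B>' f. design_of_order n (path_graph 3) \<B>' \<and> down_link \<B> \<B>' f)}"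

end

theory Submission
  imports Defs "HOL-Library.Transitive_Closure_Table"
begin

text \<open>A decomposition of a graph into \<open>k\<close>-stars is the same as an orientation all of whose out-degrees
  are multiples of \<open>k\<close>, obtained by orienting every edge away from the centre of its star.

  Necessity. A \<open>P\<^sub>3\<close>-design forces an even number of edges, that is \<open>n \<equiv> 0, 1\<close> modulo \<open>4\<close>.  The image of a
  star contains its centre, and an edge between two vertices that are not centres could not be covered, so
  \<open>n \<ge> v - 1\<close>.  For \<open>v > 2k\<close> Landau's criterion yields a tournament with nearly equal scores, all of
  them positive multiples of \<open>k\<close>; in the corresponding design every vertex is a centre, so \<open>n \<ge> v\<close>.

  Sufficiency. A connected graph with an even number of edges has an orientation with even out-degrees,
  hence a \<open>P\<^sub>3\<close>-decomposition.  So it suffices to choose a \<open>P\<^sub>3\<close> in each star such that the remaining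
  edges of \<open>K\<^sub>n\<close> form a connected graph, which is possible as soon as every star has at least four leaves.
  When \<open>v = 2k\<close> and \<open>n = 2k - 1\<close>, the congruence makes \<open>k\<close> odd, and there are fewer stars than
  vertices; deleting a vertex that is not a centre leaves stars with at least \<open>k - 1 \<ge> 4\<close> leaves.\<close>

section \<open>Orientations\<close>

text \<open>\<open>g e\<close> is the tail of \<open>e\<close>. Storing an orientation as a choice
  of tails makes the reversal of an edge a function update.\<close>

definition orients :: "'a set set \<Rightarrow> ('a set \<Rightarrow> 'a) \<Rightarrow> bool" where
  "orients E g \<longleftrightarrow> (\<forall>e\<in>E. g e \<in> e)"

definition outdeg :: "'a set set \<Rightarrow> ('a set \<Rightarrow> 'a) \<Rightarrow> 'a \<Rightarrow> nat" where
  "outdeg E g u = card {e\<in>E. g e = u}"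

lemma sum_outdeg:
  assumes "finite E" "finite R"
  shows "(\<Sum>u\<in>R. outdeg E g u) = card {e\<in>E. g e \<in> R}"
proof -
  have "{e\<in>E. g e \<in> R} = (\<Union>u\<in>R. {e\<in>E. g e = u})" by auto
  then have "card {e\<in>E. g e \<in> R} = (\<Sum>u\<in>R. card {e\<in>E. g e = u})"
    using assms by (simp only:) (rule card_UN_disjoint, auto)
  then show ?thesis by (simp add: outdeg_def)
qed

lemma exists_orientation:
  assumes "\<forall>e\<in>E. card e = 2"
  shows "\<exists>g. orients E g"
proof -
  have "\<forall>e\<in>E. (SOME x. x \<in> e) \<in> e"
    using assms by (metis all_not_in_conv card.empty some_in_eq zero_neq_numeral)
  then show ?thesis unfolding orients_def by (rule exI[of _ "\<lambda>e. SOME x. x \<in> e"])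
qed

section \<open>Path reversal and prescribed out-degrees\<close>

lemma outdeg_flip:
  assumes "finite E" "orients E g" "{x, z} \<in> E" "x \<noteq> z" "g {x, z} = x"
  shows "orients E (g({x, z} := z))"
    and "outdeg E (g({x, z} := z)) u + of_bool (u = x) = outdeg E g u + of_bool (u = z)"
proof -
  let ?g = "g({x, z} := z)"
  show "orients E ?g" using assms unfolding orients_def by auto
  consider "u = x" | "u = z" | "u \<noteq> x" "u \<noteq> z" by blast
  then show "outdeg E ?g u + of_bool (u = x) = outdeg E g u + of_bool (u = z)"
  proof cases
    case 1
    have "{e\<in>E. g e = x} = insert {x, z} {e\<in>E. ?g e = x}"
      using assms by auto
    then show ?thesis unfolding outdeg_def using 1 assms by simp
  next
    case 2
    have "{e\<in>E. ?g e = z} = insert {x, z} {e\<in>E. g e = z}"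
      using assms by auto
    then show ?thesis unfolding outdeg_def using 2 assms by simp
  next
    case 3
    have "{e\<in>E. ?g e = u} = {e\<in>E. g e = u}"
      using assms 3 by auto
    then show ?thesis unfolding outdeg_def using 3 by simp
  qed
qed

text \<open>Reversing a directed path from \<open>x\<close> to \<open>y\<close> takes one out-edge
  from \<open>x\<close> and gives one to \<open>y\<close>; every inner vertex loses one and gains
  one. The \<open>of_bool\<close> terms on both sides express this without subtraction and also
  cover \<open>x = y\<close>.\<close>

lemma path_reversal:
  assumes "finite E" "orients E g"
    and "rtrancl_path (\<lambda>u w. u \<noteq> w \<and> {u, w} \<in> E \<and> g {u, w} = u) x p y"
    and "distinct (x # p)"
  shows "\<exists>g'. orients E g' \<and>
    (\<forall>u. outdeg E g' u + of_bool (u = x) = outdeg E g u + of_bool (u = y))"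
  using assms(2-)
proof (induction p arbitrary: x g)
  case Nil
  then show ?case by (auto elim: rtrancl_path.cases)
next
  case (Cons z p)
  from Cons.prems(2) have xz: "x \<noteq> z" "{x, z} \<in> E" "g {x, z} = x"
    and p: "rtrancl_path (\<lambda>u w. u \<noteq> w \<and> {u, w} \<in> E \<and> g {u, w} = u) z p y"
    by (auto elim: rtrancl_path.cases)
  let ?g = "g({x, z} := z)"
  \<comment> \<open>The rest of the path stays directed when its first edge is reversed: it avoids
    \<open>x\<close>, so \<open>{x, z}\<close> is not one of its edges.\<close>
  have "rtrancl_path (\<lambda>u w. u \<noteq> w \<and> {u, w} \<in> E \<and> ?g {u, w} = u) a q b"
    if "rtrancl_path (\<lambda>u w. u \<noteq> w \<and> {u, w} \<in> E \<and> g {u, w} = u) a q b"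
      and "x \<notin> set (a # q)" for a q b
    using that
  proof (induction rule: rtrancl_path.induct)
    case (base a)
    show ?case by (rule rtrancl_path.base)
  next
    case (step a b bs c)
    then have "?g {a, b} = g {a, b}" by (auto simp: doubleton_eq_iff)
    then show ?case using step by (intro rtrancl_path.step) auto
  qed
  from this[OF p] Cons.prems(3)
  have "rtrancl_path (\<lambda>u w. u \<noteq> w \<and> {u, w} \<in> E \<and> ?g {u, w} = u) z p y"
    by auto
  moreover note flip = outdeg_flip[OF assms(1) Cons.prems(1) xz(2,1,3)]
  moreover have "distinct (z # p)" using Cons.prems(3) by simp
  ultimately obtain g' where g': "orients E g'"
    "\<And>u. outdeg E g' u + of_bool (u = z) = outdeg E ?g u + of_bool (u = y)"
    using Cons.IH[of ?g z] by blast
  have "outdeg E g' u + of_bool (u = x) = outdeg E g u + of_bool (u = y)" for u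
    using g'(2)[of u] flip(2)[of u] by simp
  with g'(1) show ?case by blast
qed

text \<open>Landau's criterion, for arbitrary graphs (Hakimi). Take an orientation with the least
  total deficit. If \<open>u\<close> has a surplus, no vertex reachable from \<open>u\<close> has a
  deficit, as reversing a path to it would lower the total. The reachable set \<open>R\<close> then
  has more than \<open>sum t R\<close> out-edges, all of them inside \<open>R\<close>, against the
  hypothesis.\<close>

theorem orientation_with_outdegrees:
  fixes t :: "'a \<Rightarrow> nat"
  assumes "finite V" and E: "\<forall>e\<in>E. e \<subseteq> V \<and> card e = 2"
    and le: "\<And>R. R \<subseteq> V \<Longrightarrow> card {e\<in>E. e \<subseteq> R} \<le> sum t R"
    and total: "card E = sum t V"
  shows "\<exists>g. orients E g \<and> (\<forall>u\<in>V. outdeg E g u = t u)"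
proof -
  have finE: "finite E"
    using assms(1) E by (auto intro: finite_subset[of _ "Pow V"])
  \<comment> \<open>Truncated subtraction counts deficits only; a vertex with a surplus contributes
    \<open>0\<close>.\<close>
  define gap where "gap g = (\<Sum>u\<in>V. t u - outdeg E g u)" for g
  obtain g where g: "orients E g" and min: "\<And>g'. orients E g' \<Longrightarrow> gap g \<le> gap g'"
    using exists_orientation[of E] E
      ex_has_least_nat[of "orients E" _ gap] by blast
  have sumdeg: "sum (outdeg E g) V = sum t V"
  proof -
    have "{e\<in>E. g e \<in> V} = E" using g E unfolding orients_def by auto
    then show ?thesis using sum_outdeg[OF finE assms(1), of g] total by simp
  qed
  have "outdeg E g u \<le> t u" if "u \<in> V" for u
  proof (rule ccontr)
    assume surplus: "\<not> outdeg E g u \<le> t u"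
    let ?r = "\<lambda>u w. u \<noteq> w \<and> {u, w} \<in> E \<and> g {u, w} = u"
    define R where "R = {w \<in> V. ?r\<^sup>*\<^sup>* u w}"
    have "R \<subseteq> V" "finite R" "u \<in> R" using assms(1) that by (auto simp: R_def)
    have deficit: "t w \<le> outdeg E g w" if "w \<in> R" for w
    proof (rule ccontr)
      assume w: "\<not> t w \<le> outdeg E g w"
      have "?r\<^sup>*\<^sup>* u w" "w \<in> V" using that by (simp_all add: R_def)
      then obtain q where "rtrancl_path ?r u q w"
        unfolding rtranclp_eq_rtrancl_path by blast
      then obtain p where "rtrancl_path ?r u p w" "distinct (u # p)"
        by (rule rtrancl_path_distinct) blast
      then obtain g' where g': "orients E g'"
        "\<And>y. outdeg E g' y + of_bool (y = u) = outdeg E g y + of_bool (y = w)"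
        using path_reversal[OF finE g] by blast
      have "gap g' < gap g"
        unfolding gap_def
      proof (rule sum_strict_mono_ex1)
        \<comment> \<open>The surplus at \<open>u\<close> means that losing one out-edge creates no
          deficit there.\<close>
        show "\<forall>y\<in>V. t y - outdeg E g' y \<le> t y - outdeg E g y"
        proof
          fix y assume "y \<in> V"
          show "t y - outdeg E g' y \<le> t y - outdeg E g y"
            using g'(2)[of y] surplus w by (cases "y = u"; cases "y = w") auto
        qed
        have "u \<noteq> w" using surplus w by auto
        then have "t w - outdeg E g' w < t w - outdeg E g w"
          using g'(2)[of w] w by auto
        then show "\<exists>y\<in>V. t y - outdeg E g' y < t y - outdeg E g y"
          using \<open>w \<in> V\<close> by blast
      qed (use assms(1) in auto)
      then show False using min[OF g'(1)] by simp
    qed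
    have "sum t R < sum (outdeg E g) R"
    proof (rule sum_strict_mono_ex1)
      show "\<exists>w\<in>R. t w < outdeg E g w" using \<open>u \<in> R\<close> surplus by (auto simp: not_le)
    qed (use \<open>finite R\<close> deficit in auto)
    also have "\<dots> = card {e\<in>E. g e \<in> R}"
      by (rule sum_outdeg[OF finE \<open>finite R\<close>])
    also have "\<dots> \<le> card {e\<in>E. e \<subseteq> R}"
    proof (rule card_mono)
      \<comment> \<open>\<open>R\<close> is closed under following directed edges, so an edge with
        its tail in \<open>R\<close> has its head there too.\<close>
      show "{e\<in>E. g e \<in> R} \<subseteq> {e\<in>E. e \<subseteq> R}"
      proof clarify
        fix e y assume e: "e \<in> E" "g e \<in> R" "y \<in> e"
        have "g e \<in> e" using g e by (simp add: orients_def)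
        show "y \<in> R"
        proof (cases "y = g e")
          case False
          have "e = {g e, y}"
            using E e \<open>g e \<in> e\<close> False by (auto simp: card_2_iff)
          then have "?r (g e) y" using e(1) False by auto
          moreover have "?r\<^sup>*\<^sup>* u (g e)" using e(2) by (simp add: R_def)
          ultimately have "?r\<^sup>*\<^sup>* u y" by (simp add: rtranclp.rtrancl_into_rtrancl)
          then show ?thesis using E e by (auto simp: R_def)
        qed (use e in simp)
      qed
    qed (use finE in simp)
    also have "\<dots> \<le> sum t R" by (rule le[OF \<open>R \<subseteq> V\<close>])
    finally show False by simp
  qed
  \<comment> \<open>Both sides have the same sum over \<open>V\<close>, so the inequality at every
    vertex is an equality.\<close>
  then have "outdeg E g u = t u" if "u \<in> V" for u
    using sum_mono_inv[OF sumdeg] assms(1) that by blast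
  then show ?thesis using g by blast
qed

section \<open>Even out-degrees in connected graphs\<close>

text \<open>Reversing an edge toggles the out-degree parity at both of its ends. Along a walk the
  toggles cancel except at the two end vertices, and altogether if these coincide. Unlike in
  \<open>path_reversal\<close>, the walk may ignore directions and repeat vertices.\<close>

lemma parity_flip:
  assumes "finite E" "\<forall>e\<in>E. card e = 2"
    and "(\<lambda>u w. {u, w} \<in> E)\<^sup>*\<^sup>* x y" "orients E g"
  shows "\<exists>g'. orients E g' \<and>
    (\<forall>u. even (outdeg E g' u) \<longleftrightarrow> (even (outdeg E g u) \<longleftrightarrow> (u = x \<longleftrightarrow> u = y)))"
  using assms(3)
proof (induction rule: rtranclp_induct)
  case base
  then show ?case using assms(4) by blast
next
  case (step y z)
  then obtain g' where g': "orients E g'"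
    "\<And>u. even (outdeg E g' u) \<longleftrightarrow> (even (outdeg E g u) \<longleftrightarrow> (u = x \<longleftrightarrow> u = y))"
    by blast
  have "y \<noteq> z" using step(2) assms(2) by force
  have "g' {y, z} \<in> {y, z}" using g'(1) step(2) unfolding orients_def by blast
  \<comment> \<open>The ends are renamed so that \<open>a\<close> is the current tail, whichever way
    the walk traverses the edge.\<close>
  then obtain a b where ab: "{y, z} = {a, b}" "g' {a, b} = a"
    by (metis insert_commute insert_iff singleton_iff)
  then have "a \<noteq> b" "{a, b} \<in> E" using \<open>y \<noteq> z\<close> step(2) by auto
  note flip = outdeg_flip[OF assms(1) g'(1) this(2,1) ab(2)]
  have "even (outdeg E (g'({a, b} := b)) u) \<longleftrightarrow> (even (outdeg E g u) \<longleftrightarrow> (u = x \<longleftrightarrow> u = z))" for u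
  proof -
    have "even (outdeg E (g'({a, b} := b)) u) \<longleftrightarrow> (even (outdeg E g' u) \<longleftrightarrow> (u = a \<longleftrightarrow> u = b))"
      using arg_cong[OF flip(2)[of u], of even] \<open>a \<noteq> b\<close> by auto
    moreover have "(u = a \<longleftrightarrow> u = b) \<longleftrightarrow> (u = y \<longleftrightarrow> u = z)"
      using ab(1) by (metis doubleton_eq_iff)
    ultimately show ?thesis using g'(2)[of u] by auto
  qed
  then show ?case using flip(1) by blast
qed

text \<open>A walk to \<open>x\<close> pushes an odd parity from any vertex to \<open>x\<close>, so
  all other vertices can be made even one after another. The out-degrees add up to the even number
  \<open>card E\<close>, hence \<open>x\<close> is even as well.\<close>

theorem even_orientation:
  assumes "finite V" and E: "\<forall>e\<in>E. e \<subseteq> V \<and> card e = 2" and "even (card E)"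
    and conn: "\<And>y. y \<in> V \<Longrightarrow> (\<lambda>u w. {u, w} \<in> E)\<^sup>*\<^sup>* y x"
  shows "\<exists>g. orients E g \<and> (\<forall>u. even (outdeg E g u))"
proof -
  have finE: "finite E"
    using assms(1) E by (auto intro: finite_subset[of _ "Pow V"])
  have "\<exists>g. orients E g \<and> (\<forall>u\<in>S. even (outdeg E g u))" if "finite S" "S \<subseteq> V - {x}" for S
    using that
  proof (induction rule: finite_induct)
    case empty
    then show ?case using exists_orientation[of E] E by auto
  next
    case (insert y S)
    then obtain g where g: "orients E g" "\<forall>u\<in>S. even (outdeg E g u)" by auto
    show ?case
    proof (cases "even (outdeg E g y)")
      case False
      from insert.prems conn have "(\<lambda>u w. {u, w} \<in> E)\<^sup>*\<^sup>* y x" by auto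
      then obtain g' where g': "orients E g'"
        "\<And>u. even (outdeg E g' u) \<longleftrightarrow> (even (outdeg E g u) \<longleftrightarrow> (u = y \<longleftrightarrow> u = x))"
        using parity_flip[OF finE _ _ g(1)] E by blast
      have "\<forall>u\<in>insert y S. even (outdeg E g' u)"
        using g'(2) g(2) False insert by auto
      then show ?thesis using g'(1) by blast
    qed (use g in auto)
  qed
  from this[of "V - {x}"] assms(1) obtain g where g: "orients E g"
    "\<forall>u\<in>V - {x}. even (outdeg E g u)" by auto
  have out: "outdeg E g u = 0" if "u \<notin> V" for u
  proof -
    have "{e\<in>E. g e = u} = {}" using that g(1) E unfolding orients_def by auto
    then show ?thesis by (simp only: outdeg_def card.empty)
  qed
  have "even (outdeg E g x)"
  proof (cases "x \<in> V")
    case True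
    have "{e\<in>E. g e \<in> V} = E" using g(1) E unfolding orients_def by auto
    then have "sum (outdeg E g) V = card E"
      using sum_outdeg[OF finE assms(1), of g] by simp
    then have "outdeg E g x + sum (outdeg E g) (V - {x}) = card E"
      using sum.remove[OF assms(1) True, of "outdeg E g"] by simp
    moreover have "even (sum (outdeg E g) (V - {x}))"
      using g(2) by (intro dvd_sum) auto
    ultimately show ?thesis using assms(3) by (metis even_add)
  qed (simp add: out)
  then have "even (outdeg E g u)" for u
    using g(2) out by (cases "u = x"; cases "u \<in> V") auto
  then show ?thesis using g(1) by blast
qed

section \<open>Stars and their isomorphism types\<close>

definition star_on :: "'a \<Rightarrow> 'a set \<Rightarrow> 'a sgraph" where
  "star_on c L = \<lparr>Verts = insert c L, Edges = (\<lambda>l. {c, l}) ` L\<rparr>"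

lemma simple_star_on: "finite L \<Longrightarrow> c \<notin> L \<Longrightarrow> simple_graph (star_on c L)"
  by (auto simp: simple_graph_def star_on_def card_insert_if)

lemma card_Edges_isomorphic:
  assumes "simple_graph G" "isomorphic G H"
  shows "card (Edges H) = card (Edges G)"
proof -
  obtain f where f: "bij_betw f (Verts G) (Verts H)" "Edges H = (\<lambda>e. f ` e) ` Edges G"
    using assms(2) by (auto simp: isomorphic_def)
  have "inj_on (\<lambda>e. f ` e) (Edges G)"
  proof (rule inj_onI)
    fix a b assume "a \<in> Edges G" "b \<in> Edges G" "f ` a = f ` b"
    moreover have "inj_on f (Verts G)" using f by (simp add: bij_betw_def)
    ultimately show "a = b"
      using assms(1) unfolding simple_graph_def by (metis inj_on_image_eq_iff)
  qed
  then show ?thesis using f(2) by (simp add: card_image)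
qed

text \<open>The centre is the preimage of \<open>0\<close> under the isomorphism and the leaves are
  the preimages of \<open>{1..k}\<close>.\<close>

lemma isomorphic_star_graphD:
  assumes "simple_graph B" "isomorphic B (star_graph k)"
  shows "\<exists>c L. B = star_on c L \<and> c \<notin> L \<and> finite L \<and> card L = k"
proof -
  obtain f where f: "bij_betw f (Verts B) {0..k}"
    and ed: "{{0, i} |i. i \<in> {1..k}} = (\<lambda>e. f ` e) ` Edges B"
    using assms(2) by (auto simp: isomorphic_def star_graph_def)
  define h where "h = inv_into (Verts B) f"
  have h: "bij_betw h {0..k} (Verts B)"
    unfolding h_def by (rule bij_betw_inv_into[OF f])
  have hf: "h (f u) = u" if "u \<in> Verts B" for u
    using that f by (simp add: h_def bij_betw_inv_into_left)
  have sub: "e \<subseteq> Verts B" if "e \<in> Edges B" for e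
    using assms(1) that by (auto simp: simple_graph_def)
  have hfe: "h ` f ` e = e" if "e \<in> Edges B" for e
    using sub[OF that] hf by (force simp: image_image)
  have iv: "{0..k} = insert 0 {1..k}" by auto
  have "Edges B = (\<lambda>e. h ` e) ` (\<lambda>e. f ` e) ` Edges B"
    using hfe by (force simp: image_image)
  also have "\<dots> = (\<lambda>l. {h 0, l}) ` h ` {1..k}"
  proof -
    have "{{0, i} |i. i \<in> {1..k}} = (\<lambda>i. {0, i}) ` {1..k}" by auto
    then show ?thesis unfolding ed[symmetric] by (simp add: image_image)
  qed
  finally have "Edges B = (\<lambda>l. {h 0, l}) ` h ` {1..k}" .
  moreover have "Verts B = insert (h 0) (h ` {1..k})"
    using h iv unfolding bij_betw_def by (metis image_insert)
  ultimately have "B = star_on (h 0) (h ` {1..k})" by (simp add: star_on_def)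
  moreover have inj: "inj_on h {0..k}" using h by (simp add: bij_betw_def)
  then have "h 0 \<notin> h ` {1..k}" by (force simp: inj_on_def)
  moreover have "card (h ` {1..k}) = k"
    using card_image[OF inj_on_subset[OF inj, of "{1..k}"]] by auto
  ultimately show ?thesis by blast
qed

lemma isomorphic_star_on:
  assumes "finite L" "c \<notin> L" "card L = k"
  shows "isomorphic (star_on c L) (star_graph k)"
proof -
  obtain h where h: "bij_betw h L {1..k}"
    using finite_same_card_bij[of L "{1..k}"] assms by auto
  define f where "f = h(c := 0)"
  have fL: "f ` L = {1..k}" "\<And>l. l \<in> L \<Longrightarrow> f l = h l"
    using h assms(2) by (auto simp: f_def bij_betw_def image_iff)
  have "h l \<noteq> 0" if "l \<in> L" for l
    using bij_betwE[OF h] that by force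
  then have "inj_on f (insert c L)"
    using h assms(2) by (auto simp: f_def bij_betw_def inj_on_def)
  moreover have "f ` insert c L = {0..k}"
    using fL(1) by (auto simp: f_def)
  ultimately have "bij_betw f (Verts (star_on c L)) (Verts (star_graph k))"
    by (simp add: bij_betw_def star_on_def star_graph_def)
  moreover have "Edges (star_graph k) = (\<lambda>e. f ` e) ` Edges (star_on c L)"
  proof -
    have "Edges (star_graph k) = (\<lambda>i. {0, i}) ` f ` L"
      unfolding fL(1) by (auto simp: star_graph_def)
    also have "\<dots> = (\<lambda>e. f ` e) ` Edges (star_on c L)"
    proof -
      have "f c = 0" by (simp add: f_def)
      then show ?thesis by (simp add: star_on_def image_image)
    qed
    finally show ?thesis .
  qed
  ultimately show ?thesis unfolding isomorphic_def by blast
qed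

text \<open>The path on three vertices is the star with two leaves, centred at its middle vertex
  \<open>1\<close>. Thus both kinds of designs can be handled through
  \<open>star_on\<close>.\<close>

lemma isomorphic_path3_star_on:
  assumes "c \<notin> L" "card L = 2"
  shows "isomorphic (star_on c L) (path_graph 3)"
proof -
  obtain a b where L: "L = {a, b}" "a \<noteq> b" using assms(2) by (auto simp: card_2_iff)
  define f where "f = (\<lambda>_. 0 :: nat)(c := 1, b := 2)"
  have f: "f c = 1" "f a = 0" "f b = 2" using L assms(1) by (auto simp: f_def)
  have "{..<3} = {0, 1, 2 :: nat}" by auto
  then have "bij_betw f (Verts (star_on c L)) (Verts (path_graph 3))"
    using f L assms(1) by (auto simp: bij_betw_def star_on_def path_graph_def)
  moreover have "Edges (path_graph 3) = {{0, 1}, {1, 2}}"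
  proof -
    have "Suc i < 3 \<longleftrightarrow> i = 0 \<or> i = 1" for i by auto
    then show ?thesis by (auto simp: path_graph_def numeral_2_eq_2)
  qed
  then have "Edges (path_graph 3) = (\<lambda>e. f ` e) ` Edges (star_on c L)"
    using f L by (auto simp: star_on_def insert_commute)
  ultimately show ?thesis unfolding isomorphic_def by blast
qed

section \<open>Star decompositions from orientations\<close>

lemma partition_into_k_sets:
  assumes "finite A" "k > 0" "k dvd card A"
  shows "\<exists>P. partition_on A P \<and> (\<forall>X\<in>P. card X = k)"
  using assms
proof (induction "card A" arbitrary: A rule: less_induct)
  case less
  show ?case
  proof (cases "A = {}")
    case True
    then show ?thesis by (auto intro!: exI[of _ "{}"] simp: partition_on_def)
  next
    case False
    then have "k \<le> card A" using less by (auto intro: dvd_imp_le simp: card_gt_0_iff)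
    then obtain X where X: "X \<subseteq> A" "card X = k" "finite X"
      by (metis obtain_subset_with_card_n)
    have c: "card (A - X) = card A - k" using X by (simp add: card_Diff_subset)
    then have "card (A - X) < card A" using \<open>k \<le> card A\<close> less.prems by simp
    moreover have "k dvd card (A - X)" using c less.prems by simp
    ultimately obtain P where P: "partition_on (A - X) P" "\<forall>Y\<in>P. card Y = k"
      using less.hyps[of "A - X"] less.prems by blast
    have "X \<noteq> {}" using X less.prems by auto
    then have "partition_on A (insert X P)"
      using P(1) X(1) by (subst partition_on_insert) (auto simp: disjnt_def partition_on_def)
    then show ?thesis using P(2) X(2) by (intro exI[of _ "insert X P"]) auto
  qed
qed

lemma partition_on_UN:
  assumes "\<And>u. partition_on {e\<in>E. g e = u} (P u)"
  shows "partition_on E (\<Union>u. P u)"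
proof (rule partition_onI)
  have "\<Union> (P u) = {e\<in>E. g e = u}" for u using assms[of u] by (simp add: partition_on_def)
  note un = this
  have "\<Union> (\<Union>u. P u) = (\<Union>u. \<Union> (P u))" by blast
  also have "\<dots> = E" unfolding un by blast
  finally show "\<Union> (\<Union>u. P u) = E" .
  show "{} \<notin> (\<Union>u. P u)"
    using assms unfolding partition_on_def by blast
  fix p q assume p: "p \<in> (\<Union>u. P u)" "q \<in> (\<Union>u. P u)" "p \<noteq> q"
  then obtain u w where uw: "p \<in> P u" "q \<in> P w" by blast
  show "disjnt p q"
  proof (cases "u = w")
    case True
    then show ?thesis
      using assms[of u] uw p(3) unfolding partition_on_def disjoint_def disjnt_def by blast
  next
    case False
    moreover have "p \<subseteq> {e\<in>E. g e = u}" "q \<subseteq> {e\<in>E. g e = w}"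
      using un[of u] un[of w] uw by blast+
    ultimately show ?thesis unfolding disjnt_def by blast
  qed
qed

text \<open>The out-edges of each vertex are cut into groups of \<open>k\<close>, each group being a
  star. The clause \<open>g e = c\<close> records that the centre is the tail, so a positive
  out-degree makes a vertex a centre. For \<open>k = 2\<close> the stars are paths.\<close>

theorem star_partition:
  assumes "finite E" "\<forall>e\<in>E. card e = 2" "orients E g" "k > 0" "\<And>u. k dvd outdeg E g u"
  shows "\<exists>\<S>. (\<forall>B\<in>\<S>. \<exists>c L. B = star_on c L \<and> c \<notin> L \<and> finite L \<and> card L = k \<and>
      (\<forall>e\<in>Edges B. g e = c)) \<and> partition_on E (Edges ` \<S>)"
proof -
  have "\<exists>P. partition_on {e\<in>E. g e = u} P \<and> (\<forall>X\<in>P. card X = k)" for u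
    using partition_into_k_sets[of "{e\<in>E. g e = u}" k] assms by (simp add: outdeg_def)
  then obtain P where P: "\<And>u. partition_on {e\<in>E. g e = u} (P u)"
    "\<And>u X. X \<in> P u \<Longrightarrow> card X = k" by metis
  \<comment> \<open>A block is recovered from its edges alone. This agrees with
    \<open>star_on\<close> because \<open>k > 0\<close> leaves no star without edges.\<close>
  define \<S> where "\<S> = (\<lambda>X. \<lparr>Verts = \<Union>X, Edges = X\<rparr>) ` (\<Union>u. P u)"
  have "Edges ` \<S> = (\<Union>u. P u)" by (auto simp: \<S>_def image_image)
  then have "partition_on E (Edges ` \<S>)" using partition_on_UN[OF P(1)] by simp
  moreover have "\<exists>c L. B = star_on c L \<and> c \<notin> L \<and> finite L \<and> card L = k \<and>
      (\<forall>e\<in>Edges B. g e = c)" if BS: "B \<in> \<S>" for B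
  proof -
    obtain u X where B: "X \<in> P u" "B = \<lparr>Verts = \<Union>X, Edges = X\<rparr>"
      using BS unfolding \<S>_def by blast
    have X: "X \<subseteq> {e\<in>E. g e = u}" "X \<noteq> {}" "finite X" "card X = k"
      using P(1)[of u] P(2)[OF B(1)] B(1) assms(4) card_gt_0_iff[of X]
      unfolding partition_on_def by auto
    have e: "\<exists>l. l \<noteq> u \<and> e = {u, l}" if "e \<in> X" for e
    proof -
      have "u \<in> e" "card e = 2" using that X(1) assms(2,3) by (auto simp: orients_def)
      then show ?thesis by (auto simp: card_2_iff)
    qed
    define L where "L = {l. l \<noteq> u \<and> {u, l} \<in> X}"
    have XL: "X = (\<lambda>l. {u, l}) ` L" using e by (auto simp: L_def)
    have "inj_on (\<lambda>l. {u, l}) L" by (auto simp: inj_on_def doubleton_eq_iff)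
    then have L: "finite L" "card L = k"
      using X XL by (auto simp: finite_image_iff card_image)
    have "L \<noteq> {}" using X(2) XL by auto
    then have "B = star_on u L" using B(2) XL by (auto simp: star_on_def)
    moreover have "u \<notin> L" by (simp add: L_def)
    moreover have "\<forall>e\<in>Edges B. g e = u" using B(2) X(1) by auto
    ultimately show ?thesis using L by blast
  qed
  ultimately show ?thesis by blast
qed

section \<open>Path designs through a star design\<close>

text \<open>A decomposition of the complete graph on \<open>V\<close> into stars of possibly
  different sizes. The separate index set keeps the identity of a star when its leaf set
  shrinks.\<close>

definition star_cover ::
  "'a set \<Rightarrow> 'i set \<Rightarrow> ('i \<Rightarrow> 'a) \<Rightarrow> ('i \<Rightarrow> 'a set) \<Rightarrow> bool" where
  "star_cover V I c L \<longleftrightarrow> (\<forall>i\<in>I. c i \<in> V \<and> L i \<subseteq> V - {c i}) \<and>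
     (\<forall>a\<in>V. \<forall>b\<in>V. a \<noteq> b \<longrightarrow> (\<exists>!i. i \<in> I \<and> {a, b} \<in> (\<lambda>l. {c i, l}) ` L i))"

lemma star_cover_unique:
  assumes "star_cover V I c L" "i \<in> I" "j \<in> I"
    and "e \<in> (\<lambda>l. {c i, l}) ` L i" "e \<in> (\<lambda>l. {c j, l}) ` L j"
  shows "i = j"
proof -
  obtain l where l: "l \<in> L i" "e = {c i, l}" using assms(4) by blast
  then have "c i \<in> V" "l \<in> V" "c i \<noteq> l" using assms(1,2) by (auto simp: star_cover_def)
  then have "\<exists>!i. i \<in> I \<and> e \<in> (\<lambda>l. {c i, l}) ` L i"
    using assms(1) l(2) by (simp add: star_cover_def)
  then show ?thesis using assms(2-5) by (elim ex1E) metis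
qed

text \<open>As \<open>x\<close> is not a centre, deleting it costs each star at most one leaf and
  destroys no star. This serves the order \<open>2 * k - 1\<close>.\<close>

lemma star_cover_delete_vertex:
  assumes "star_cover V I c L" "x \<notin> c ` I"
  shows "star_cover (V - {x}) I c (\<lambda>i. L i - {x})"
  unfolding star_cover_def
proof (intro conjI ballI impI)
  fix a b assume ab: "a \<in> V - {x}" "b \<in> V - {x}" "a \<noteq> b"
  have "{a, b} \<in> (\<lambda>l. {c i, l}) ` (L i - {x}) \<longleftrightarrow> {a, b} \<in> (\<lambda>l. {c i, l}) ` L i" for i
    using ab by (auto simp: image_iff doubleton_eq_iff)
  then show "\<exists>!i. i \<in> I \<and> {a, b} \<in> (\<lambda>l. {c i, l}) ` (L i - {x})"
    using assms(1) ab unfolding star_cover_def by simp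
qed (use assms in \<open>auto simp: star_cover_def\<close>)

text \<open>Two stars with the same centre and the same nonempty leaf set share an edge, so pairs of
  centre and leaf set identify the indices.\<close>

lemma star_cover_finite:
  assumes "finite V" "star_cover V I c L" "\<forall>i\<in>I. L i \<noteq> {}"
  shows "finite I"
proof (rule finite_imageD)
  show "finite ((\<lambda>i. (c i, L i)) ` I)"
    by (rule finite_subset[of _ "V \<times> Pow V"])
      (use assms in \<open>auto simp: star_cover_def\<close>)
  show "inj_on (\<lambda>i. (c i, L i)) I"
  proof (rule inj_onI)
    fix i j assume ij: "i \<in> I" "j \<in> I" "(c i, L i) = (c j, L j)"
    obtain l where "l \<in> L i" using assms(3) ij(1) by auto
    then show "i = j" using star_cover_unique[OF assms(2) ij(1,2), of "{c i, l}"] ij(3) by auto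
  qed
qed

text \<open>The stars centred at \<open>x\<close> have pairwise disjoint leaf sets, all inside
  \<open>V - {x}\<close>.\<close>

lemma few_stars_at_vertex:
  assumes "finite V" "star_cover V I c L" "\<forall>i\<in>I. k \<le> card (L i)" "0 < k" "x \<in> V"
  shows "k * card {i\<in>I. c i = x} \<le> card V - 1"
proof -
  let ?I = "{i\<in>I. c i = x}"
  have fin: "finite (L i)" if "i \<in> I" for i
    using assms(1,2) that unfolding star_cover_def by (meson finite_Diff finite_subset)
  have "finite I"
    using star_cover_finite[OF assms(1,2)] assms(3,4) by (metis card.empty not_le)
  have "k * card ?I \<le> (\<Sum>i\<in>?I. card (L i))"
    using sum_mono[of ?I "\<lambda>_. k" "\<lambda>i. card (L i)"] assms(3) by (simp add: mult.commute)
  also have "\<dots> = card (\<Union>i\<in>?I. L i)"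
  proof (rule card_UN_disjoint[symmetric])
    show "\<forall>i\<in>?I. \<forall>j\<in>?I. i \<noteq> j \<longrightarrow> L i \<inter> L j = {}"
    proof (intro ballI impI, rule ccontr)
      fix i j assume ij: "i \<in> ?I" "j \<in> ?I" "i \<noteq> j" "L i \<inter> L j \<noteq> {}"
      then obtain l where "l \<in> L i" "l \<in> L j" by blast
      then show False using star_cover_unique[OF assms(2), of i j "{x, l}"] ij by auto
    qed
  qed (use \<open>finite I\<close> fin in auto)
  also have "\<dots> \<le> card (V - {x})"
    by (rule card_mono) (use assms in \<open>auto simp: star_cover_def\<close>)
  finally show ?thesis using assms(1,5) by simp
qed

text \<open>Two leaves per star are selected so that the remaining edges connect every vertex to the hub
  \<open>x\<close>.  Stars at other centres avoid \<open>x\<close>, so only the set \<open>R\<close> of leaves selected at \<open>x\<close> may be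
  separated from it.  Since \<open>R\<close> has at most half of the other vertices, it can be matched into the
  rest; a star contains at most one of the matching edges, hence still has two leaves to offer when
  it keeps that edge.\<close>

lemma hub_selection:
  assumes finV: "finite V" and cov: "star_cover V I c L"
    and four: "\<forall>i\<in>I. 4 \<le> card (L i)" and "x \<in> V" and W: "V \<subseteq> W"
  obtains S where "\<And>i. i \<in> I \<Longrightarrow> S i \<subseteq> L i" "\<And>i. i \<in> I \<Longrightarrow> card (S i) = 2"
    "\<And>y. y \<in> W \<Longrightarrow>
      (\<lambda>u w. {u, w} \<in> {e. e \<subseteq> W \<and> card e = 2} - (\<Union>i\<in>I. (\<lambda>l. {c i, l}) ` S i))\<^sup>*\<^sup>* y x"
proof -
  have "finite I"
    using star_cover_finite[OF finV cov] four by (metis card.empty not_numeral_le_zero)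
  have "\<exists>T. T \<subseteq> L i \<and> card T = 2" if "i \<in> I" for i
  proof -
    have "4 \<le> card (L i)" using four that by blast
    then have "2 \<le> card (L i)" by linarith
    then show ?thesis by (metis obtain_subset_with_card_n)
  qed
  then obtain S0 where S0: "\<And>i. i \<in> I \<Longrightarrow> S0 i \<subseteq> L i \<and> card (S0 i) = 2" by metis
  let ?I = "{i\<in>I. c i = x}"
  define R where "R = (\<Union>i\<in>?I. S0 i)"
  have RV: "R \<subseteq> V - {x}" using S0 cov by (fastforce simp: R_def star_cover_def)
  have "card R \<le> (\<Sum>i\<in>?I. card (S0 i))"
    unfolding R_def using \<open>finite I\<close> by (intro card_UN_le) simp
  also have "\<dots> = 2 * card ?I" using S0 by simp
  \<comment> \<open>At least four leaves per star give \<open>4 * card ?I <= card V - 1\<close>,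
    while only two leaves of each are selected.\<close>
  finally have "2 * card R \<le> card V - 1"
    using few_stars_at_vertex[OF finV cov four _ \<open>x \<in> V\<close>] by simp
  moreover have "card (V - {x} - R) = card V - 1 - card R"
    using finV \<open>x \<in> V\<close> RV by (subst card_Diff_subset) (auto intro: finite_subset)
  ultimately have "card R \<le> card (V - {x} - R)" by simp
  then obtain h where h: "h ` R \<subseteq> V - {x} - R" "inj_on h R"
    using card_le_inj[of R "V - {x} - R"] finV RV by (meson finite_Diff finite_subset)
  have "\<exists>i\<in>I. {y, h y} \<in> (\<lambda>l. {c i, l}) ` L i" if "y \<in> R" for y
  proof -
    have "y \<in> V" "h y \<in> V" "y \<noteq> h y" using that RV h(1) by auto
    then show ?thesis using cov unfolding star_cover_def by blast
  qed
  then obtain j where j: "\<And>y. y \<in> R \<Longrightarrow> j y \<in> I \<and> {y, h y} \<in> (\<lambda>l. {c (j y), l}) ` L (j y)"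
    by metis
  have cj: "c (j y) = y \<or> c (j y) = h y" if "y \<in> R" for y
    using j[OF that] by (auto simp: doubleton_eq_iff)
  have cj_x: "c (j y) \<noteq> x" if "y \<in> R" for y
    using cj[OF that] that RV h(1) by auto
  \<comment> \<open>The matching edges are pairwise disjoint, so a common centre lies on only one of
    them.\<close>
  have inj_j: "y = y'" if "y \<in> R" "y' \<in> R" "j y = j y'" for y y'
    using cj[OF that(1)] cj[OF that(2)] that h by (auto simp: inj_on_def)
  \<comment> \<open>The leaves to avoid: the hub, and the other end of the matching edge if star
    \<open>i\<close> contains one. These are at most two, so two of the four or more leaves
    remain.\<close>
  define A where "A i = {x} \<union> {l. \<exists>y\<in>R. j y = i \<and> {c i, l} = {y, h y}}" for i
  have "\<exists>T. T \<subseteq> L i - A i \<and> card T = 2" if "i \<in> I" for i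
  proof -
    have "\<exists>l0. A i \<subseteq> {x, l0}"
    proof (cases "\<exists>y\<in>R. j y = i")
      case True
      then obtain y where y: "y \<in> R" "j y = i" by blast
      then obtain l0 where "{y, h y} = {c i, l0}" using j by blast
      have "l = l0" if l: "l \<in> A i" "l \<noteq> x" for l
      proof -
        obtain y' where y': "y' \<in> R" "j y' = i" "{c i, l} = {y', h y'}"
          using l by (auto simp: A_def)
        then have "y' = y" using inj_j y by metis
        then have "{c i, l} = {c i, l0}" using y' \<open>{y, h y} = {c i, l0}\<close> by simp
        then show ?thesis by (auto simp: doubleton_eq_iff)
      qed
      then show ?thesis by blast
    qed (auto simp: A_def)
    then obtain l0 where A: "A i \<subseteq> {x, l0}" by blast
    then have finA: "finite (A i)" by (rule finite_subset) simp
    have "card (A i) \<le> card {x, l0}" using A by (intro card_mono) auto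
    also have "\<dots> \<le> 2" by (simp add: card_insert_if)
    finally have "card (A i) \<le> 2" .
    moreover have "4 \<le> card (L i)" using four that by blast
    ultimately have "2 \<le> card (L i) - card (A i)" by linarith
    also have "\<dots> \<le> card (L i - A i)" using finA by (rule diff_card_le_card_Diff)
    finally show ?thesis by (metis obtain_subset_with_card_n)
  qed
  then obtain S1 where S1: "\<And>i. i \<in> I \<Longrightarrow> S1 i \<subseteq> L i - A i \<and> card (S1 i) = 2" by metis
  define S where "S i = (if c i = x then S0 i else S1 i)" for i
  have S: "S i \<subseteq> L i" "card (S i) = 2" if "i \<in> I" for i
    using S0[OF that] S1[OF that] by (auto simp: S_def)
  let ?M = "\<Union>i\<in>I. (\<lambda>l. {c i, l}) ` S i"
  have near: "{y, x} \<notin> ?M" if "y \<noteq> x" "y \<notin> R" for y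
  proof
    assume "{y, x} \<in> ?M"
    then obtain i l where i: "i \<in> I" "l \<in> S i" "{y, x} = {c i, l}" by auto
    then consider "c i = x" "l = y" | "c i = y" "l = x" by (auto simp: doubleton_eq_iff)
    then show False
    proof cases
      case 1
      then show False using i that(2) by (auto simp: R_def S_def)
    next
      case 2
      then have "l \<in> S1 i" using i that(1) by (simp add: S_def)
      then show False using S1[OF i(1)] 2 by (auto simp: A_def)
    qed
  qed
  have matched: "{y, h y} \<notin> ?M" if "y \<in> R" for y
  proof
    assume "{y, h y} \<in> ?M"
    then obtain i l where i: "i \<in> I" "l \<in> S i" "{y, h y} = {c i, l}" by auto
    then have "{y, h y} \<in> (\<lambda>l. {c i, l}) ` L i" using S(1) by blast
    then have "j y = i" using star_cover_unique[OF cov _ i(1)] j[OF that] by blast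
    then have "l \<in> A i" using that i(3) by (auto simp: A_def)
    moreover have "l \<in> S1 i" using i(2) cj_x[OF that] \<open>j y = i\<close> by (simp add: S_def)
    ultimately show False using S1[OF i(1)] by blast
  qed
  define r where "r u w \<longleftrightarrow> {u, w} \<in> {e. e \<subseteq> W \<and> card e = 2} - ?M" for u w
  \<comment> \<open>A vertex outside \<open>R\<close>, also one of \<open>W\<close> outside
    \<open>V\<close>, keeps its edge to the hub.\<close>
  have direct: "r\<^sup>*\<^sup>* z x" if "z \<in> W" "z \<notin> R" for z
  proof (cases "z = x")
    case False
    then have "{z, x} \<subseteq> W" "card {z, x} = 2" using that W \<open>x \<in> V\<close> by auto
    then have "r z x" unfolding r_def using near[OF False that(2)] by blast
    then show ?thesis by (rule r_into_rtranclp)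
  qed simp
  have "r\<^sup>*\<^sup>* y x" if y: "y \<in> W" for y
  proof (cases "y \<in> R")
    case True
    then have hy: "h y \<in> W" "h y \<notin> R" using h(1) W by auto
    then have "y \<noteq> h y" using True by auto
    then have "{y, h y} \<subseteq> W" "card {y, h y} = 2" using y hy by auto
    then have "r y (h y)" unfolding r_def using matched[OF True] by blast
    then show ?thesis using direct[OF hy] by (rule converse_rtranclp_into_rtranclp)
  qed (rule direct[OF y])
  then show thesis using S unfolding r_def by (intro that[of S])
qed

section \<open>Assembling the path design\<close>

text \<open>Stars with at least one leaf have no isolated vertices, so equal edge sets mean equal
  blocks and a partition of the edges suffices. Keeping \<open>iso\<close> as a hypothesis lets the
  lemma serve both star designs and path designs.\<close>

lemma graph_design_of_stars:
  fixes W :: "'a set"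
  assumes finW: "finite W" and "0 < k" "\<P> \<noteq> {}"
    and star: "\<And>B. B \<in> \<P> \<Longrightarrow> \<exists>c L. B = star_on c L \<and> c \<notin> L \<and> finite L \<and> card L = k"
    and part: "partition_on {e. e \<subseteq> W \<and> card e = 2} (Edges ` \<P>)"
    and iso: "\<And>(c :: 'a) L. c \<notin> L \<Longrightarrow> finite L \<Longrightarrow> card L = k \<Longrightarrow> isomorphic (star_on c L) \<Gamma>"
  shows "graph_design (complete_graph W) \<Gamma> \<P>"
proof -
  have Verts: "Verts B = \<Union>(Edges B)" if B: "B \<in> \<P>" for B
  proof -
    obtain c L where L: "B = star_on c L" "card L = k" using star[OF B] by blast
    then have "L \<noteq> {}" using \<open>0 < k\<close> by auto
    then show ?thesis using L(1) by (auto simp: star_on_def)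
  qed
  have sK: "simple_graph (complete_graph W)"
    using finW by (auto simp: simple_graph_def complete_graph_def)
  have sub: "subgraph B (complete_graph W)" if B: "B \<in> \<P>" for B
  proof -
    have "Edges B \<subseteq> \<Union>(Edges ` \<P>)" using B by blast
    then have e: "Edges B \<subseteq> {e. e \<subseteq> W \<and> card e = 2}"
      unfolding partition_onD1[OF part, symmetric] .
    then have "Verts B \<subseteq> W" unfolding Verts[OF B] by blast
    moreover obtain c L where "B = star_on c L" "c \<notin> L" "finite L" using star[OF B] by blast
    then have "simple_graph B" by (simp add: simple_star_on)
    ultimately show ?thesis
      using sK e by (simp add: subgraph_def complete_graph_def)
  qed
  have iso': "isomorphic B \<Gamma>" if B: "B \<in> \<P>" for B
  proof -
    obtain c L where "B = star_on c L" "c \<notin> L" "finite L" "card L = k" using star[OF B] by blast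
    then show ?thesis by (simp add: iso)
  qed
  have "inj_on Edges \<P>"
  proof (rule inj_onI)
    fix B C assume BC: "B \<in> \<P>" "C \<in> \<P>" "Edges B = Edges C"
    then have "Verts B = Verts C" using Verts by simp
    then show "B = C" using BC(3) by (intro sgraph.equality) simp_all
  qed
  moreover have "embeds \<Gamma> (complete_graph W)"
  proof -
    obtain B where "B \<in> \<P>" using \<open>\<P> \<noteq> {}\<close> by blast
    then show ?thesis using sub iso' unfolding embeds_def by (intro exI[of _ B]) simp
  qed
  moreover have "Edges (complete_graph W) = {e. e \<subseteq> W \<and> card e = 2}"
    by (simp add: complete_graph_def)
  ultimately show ?thesis
    unfolding graph_design_def using sK sub iso' part by simp
qed

lemma partition_on_Un:
  assumes "partition_on A P" "partition_on B Q" "A \<inter> B = {}"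
  shows "partition_on (A \<union> B) (P \<union> Q)"
proof (rule partition_onI)
  have un: "\<Union>P = A" "\<Union>Q = B" using assms(1,2) by (simp_all add: partition_on_def)
  then show "\<Union>(P \<union> Q) = A \<union> B" by blast
  show "{} \<notin> P \<union> Q" using assms(1,2) by (simp add: partition_on_def)
  fix p q assume pq: "p \<in> P \<union> Q" "q \<in> P \<union> Q" "p \<noteq> q"
  have "disjoint P" "disjoint Q" using assms(1,2) by (simp_all add: partition_on_def)
  then have "disjnt p q" if "p \<in> P \<and> q \<in> P \<or> p \<in> Q \<and> q \<in> Q"
    using that pq(3) by (auto dest: disjointD simp: disjnt_def)
  moreover have "disjnt p q" if "p \<in> P \<and> q \<in> Q \<or> p \<in> Q \<and> q \<in> P"
  proof -
    have "p \<subseteq> A \<and> q \<subseteq> B \<or> p \<subseteq> B \<and> q \<subseteq> A" using that un by blast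
    then show ?thesis using assms(3) unfolding disjnt_def by blast
  qed
  ultimately show "disjnt p q" using pq by blast
qed

lemma star_cover_subpartition:
  assumes "star_cover V I c L" "\<forall>i\<in>I. S i \<subseteq> L i \<and> S i \<noteq> {}"
    and Q: "Q = (\<lambda>i. (\<lambda>l. {c i, l}) ` S i) ` I"
  shows "partition_on (\<Union>Q) Q"
proof (rule partition_onI)
  fix p q assume pq: "p \<in> Q" "q \<in> Q" "p \<noteq> q"
  then obtain i j where ij: "i \<in> I" "j \<in> I" "p = (\<lambda>l. {c i, l}) ` S i" "q = (\<lambda>l. {c j, l}) ` S j"
    unfolding Q by blast
  then have sub: "p \<subseteq> (\<lambda>l. {c i, l}) ` L i" "q \<subseteq> (\<lambda>l. {c j, l}) ` L j"
    using assms(2) by (simp_all add: image_mono)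
  have "i \<noteq> j" using pq(3) ij by auto
  have "e \<notin> q" if e: "e \<in> p" for e
  proof
    assume "e \<in> q"
    then have "i = j"
      using star_cover_unique[OF assms(1) ij(1,2)] sub e by (meson subsetD)
    then show False using \<open>i \<noteq> j\<close> by simp
  qed
  then show "disjnt p q" unfolding disjnt_def by blast
next
  show "{} \<notin> Q" using assms(2) unfolding Q by auto
qed simp

text \<open>The selected pairs use \<open>2 * card Q\<close> edges, so the remaining edges of the
  complete graph on \<open>W\<close> are even in number; \<open>hub_selection\<close> makes them
  connected. An even orientation splits them into paths, which join the selected ones.\<close>

theorem path_design_through_stars:
  assumes finW: "finite W" and "V \<subseteq> W" and cov: "star_cover V I c L"
    and four: "\<forall>i\<in>I. 4 \<le> card (L i)" and "I \<noteq> {}" and even: "even (card W choose 2)"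
  shows "\<exists>\<P> S. graph_design (complete_graph W) (path_graph 3) \<P> \<and>
    (\<forall>i\<in>I. S i \<subseteq> L i \<and> star_on (c i) (S i) \<in> \<P>)"
proof -
  have finV: "finite V" using assms(1,2) by (rule finite_subset[rotated])
  obtain x where "x \<in> V" using cov \<open>I \<noteq> {}\<close> by (auto simp: star_cover_def)
  let ?K = "{e. e \<subseteq> W \<and> card e = 2}"
  obtain S where S: "\<And>i. i \<in> I \<Longrightarrow> S i \<subseteq> L i" "\<And>i. i \<in> I \<Longrightarrow> card (S i) = 2"
    and conn: "\<And>y. y \<in> W \<Longrightarrow>
      (\<lambda>u w. {u, w} \<in> ?K - (\<Union>i\<in>I. (\<lambda>l. {c i, l}) ` S i))\<^sup>*\<^sup>* y x"
    by (rule hub_selection[OF finV cov four \<open>x \<in> V\<close> \<open>V \<subseteq> W\<close>]) (rule that)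
  define Q where "Q = (\<lambda>i. (\<lambda>l. {c i, l}) ` S i) ` I"
  have ctr: "c i \<in> V" "c i \<notin> S i" "S i \<subseteq> V" if "i \<in> I" for i
    using cov S(1)[OF that] that by (auto simp: star_cover_def)
  have QK: "\<Union>Q \<subseteq> ?K"
  proof
    fix e assume "e \<in> \<Union>Q"
    then obtain i l where i: "i \<in> I" "l \<in> S i" "e = {c i, l}" by (auto simp: Q_def)
    then have "c i \<noteq> l" "c i \<in> W" "l \<in> W" using ctr[OF i(1)] \<open>V \<subseteq> W\<close> by auto
    then show "e \<in> ?K" using i(3) by simp
  qed
  have finK: "finite ?K" using finW by simp
  have cardQ: "card q = 2" if q: "q \<in> Q" for q
  proof -
    obtain i where i: "i \<in> I" "q = (\<lambda>l. {c i, l}) ` S i" using q unfolding Q_def by blast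
    have "inj_on (\<lambda>l. {c i, l}) (S i)" by (auto simp: inj_on_def doubleton_eq_iff)
    then show ?thesis using i S(2) by (simp add: card_image)
  qed
  have "S i \<noteq> {}" if "i \<in> I" for i using S(2)[OF that] by auto
  then have partQ: "partition_on (\<Union>Q) Q"
    using S(1) by (intro star_cover_subpartition[OF cov _ Q_def]) blast
  have "finite (\<Union>Q)" using QK finK by (rule finite_subset)
  have "2 * card Q = card (\<Union>Q)"
  proof (rule card_partition)
    show "finite Q" using \<open>finite (\<Union>Q)\<close> by (rule finite_UnionD)
    show "p \<inter> q = {}" if "p \<in> Q" "q \<in> Q" "p \<noteq> q" for p q
      using partition_onD2[OF partQ] that by (rule disjointD)
  qed (use \<open>finite (\<Union>Q)\<close> cardQ in blast)+
  then have "even (card (\<Union>Q))" by (metis dvd_triv_left)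
  moreover have "card ?K = card W choose 2" using n_subsets[OF finW] by simp
  moreover have "card (?K - \<Union>Q) = card ?K - card (\<Union>Q)"
    using \<open>finite (\<Union>Q)\<close> QK by (rule card_Diff_subset)
  ultimately have evenH: "even (card (?K - \<Union>Q))" using even by simp
  have H: "\<forall>e\<in>?K - \<Union>Q. e \<subseteq> W \<and> card e = 2" by simp
  have connH: "(\<lambda>u w. {u, w} \<in> ?K - \<Union>Q)\<^sup>*\<^sup>* y x" if "y \<in> W" for y
    using conn[OF that] by (simp only: Q_def)
  obtain g where g: "orients (?K - \<Union>Q) g" "\<forall>u. even (outdeg (?K - \<Union>Q) g u)"
  proof -
    have "\<exists>g. orients (?K - \<Union>Q) g \<and> (\<forall>u. even (outdeg (?K - \<Union>Q) g u))"
      by (rule even_orientation[OF finW H evenH]) (rule connH)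
    then show thesis using that by (elim exE conjE)
  qed
  have "finite (?K - \<Union>Q)" "\<forall>e\<in>?K - \<Union>Q. card e = 2" using finK by simp_all
  from star_partition[OF this g(1), of 2] g(2)
  obtain \<S> where \<S>: "\<forall>B\<in>\<S>. \<exists>c L. B = star_on c L \<and> c \<notin> L \<and> finite L \<and> card L = 2 \<and>
      (\<forall>e\<in>Edges B. g e = c)"
    "partition_on (?K - \<Union>Q) (Edges ` \<S>)"
    by auto
  define \<P> where "\<P> = \<S> \<union> (\<lambda>i. star_on (c i) (S i)) ` I"
  have "Edges ` (\<lambda>i. star_on (c i) (S i)) ` I = Q"
    by (simp add: Q_def image_image star_on_def)
  then have Ed: "Edges ` \<P> = Edges ` \<S> \<union> Q" by (simp add: \<P>_def image_Un)
  have "?K - \<Union>Q \<union> \<Union>Q = ?K" using QK by blast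
  then have part: "partition_on ?K (Edges ` \<P>)"
    unfolding Ed using partition_on_Un[OF \<S>(2) partQ] by (metis Diff_disjoint inf_commute)
  have star: "\<exists>c L. B = star_on c L \<and> c \<notin> L \<and> finite L \<and> card L = 2" if B: "B \<in> \<P>" for B
  proof (cases "B \<in> \<S>")
    case True
    then show ?thesis using \<S>(1) by blast
  next
    case False
    then obtain i where i: "i \<in> I" "B = star_on (c i) (S i)" using B unfolding \<P>_def by blast
    then have "finite (S i)" using S(2) by (intro card_ge_0_finite) simp
    then show ?thesis using i ctr(2) S(2) by blast
  qed
  have "\<P> \<noteq> {}" using \<open>I \<noteq> {}\<close> by (simp add: \<P>_def)
  have "graph_design (complete_graph W) (path_graph 3) \<P>"
    by (rule graph_design_of_stars[OF finW _ \<open>\<P> \<noteq> {}\<close> star part])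
      (simp_all add: isomorphic_path3_star_on)
  moreover have "\<forall>i\<in>I. S i \<subseteq> L i \<and> star_on (c i) (S i) \<in> \<P>"
    using S(1) by (simp add: \<P>_def)
  ultimately show ?thesis by (intro exI[of _ \<P>] exI[of _ S] conjI)
qed

section \<open>Star designs and down-links\<close>

lemma double_choose_two: "2 * (n choose 2) = n * (n - 1)"
proof -
  have "even (n * (n - 1))" by (cases n) simp_all
  then show ?thesis by (simp add: choose_two)
qed

lemma even_choose_two_iff: "even (n choose 2) \<longleftrightarrow> [n = 0] (mod 4) \<or> [n = 1] (mod 4)"
proof -
  have "\<exists>q. n = 4 * q \<or> n = 4 * q + 1 \<or> n = 4 * q + 2 \<or> n = 4 * q + 3" by presburger
  then obtain q where "n = 4 * q \<or> n = 4 * q + 1 \<or> n = 4 * q + 2 \<or> n = 4 * q + 3" ..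
  then consider "n = 4 * q" | "n = 4 * q + 1" | "n = 4 * q + 2" | "n = 4 * q + 3" by blast
  then show ?thesis
  proof cases
    case 1
    then have "n choose 2 = 2 * (q * (n - 1))" using double_choose_two[of n] by simp
    then show ?thesis using 1 by (simp add: cong_def)
  next
    case 2
    then have "n choose 2 = 2 * (q * n)" using double_choose_two[of n] by simp
    then show ?thesis using 2 by (simp add: cong_def)
  next
    case 3
    then have "n choose 2 = (2 * q + 1) * (4 * q + 1)" using double_choose_two[of n] by simp
    moreover have "n mod 4 = 2" using 3 by presburger
    ultimately show ?thesis by (simp add: cong_def)
  next
    case 4
    then have "n choose 2 = (4 * q + 3) * (2 * q + 1)" using double_choose_two[of n] by simp
    moreover have "n mod 4 = 3" using 4 by presburger
    ultimately show ?thesis by (simp add: cong_def)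
  qed
qed

section \<open>Counting blocks and reading off stars\<close>

text \<open>For path designs this yields the parity condition on the order, for star designs the
  number of blocks.\<close>

lemma card_graph_design:
  assumes "finite V" and des: "graph_design (complete_graph V) \<Gamma> \<B>"
  shows "card (Edges \<Gamma>) * card \<B> = card V choose 2"
proof -
  have inj: "inj_on Edges \<B>" and part: "partition_on {e. e \<subseteq> V \<and> card e = 2} (Edges ` \<B>)"
    using des by (simp_all add: graph_design_def complete_graph_def)
  have un: "\<Union>(Edges ` \<B>) = {e. e \<subseteq> V \<and> card e = 2}"
    using partition_onD1[OF part] by simp
  then have fin: "finite (\<Union>(Edges ` \<B>))" using assms(1) by simp
  have "card (Edges \<Gamma>) * card (Edges ` \<B>) = card (\<Union>(Edges ` \<B>))"
  proof (rule card_partition)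
    show "finite (Edges ` \<B>)" using fin by (rule finite_UnionD)
    show "p \<inter> q = {}" if "p \<in> Edges ` \<B>" "q \<in> Edges ` \<B>" "p \<noteq> q" for p q
      using partition_onD2[OF part] that by (rule disjointD)
    show "card p = card (Edges \<Gamma>)" if p: "p \<in> Edges ` \<B>" for p
    proof -
      obtain B where B: "B \<in> \<B>" "p = Edges B" using p by blast
      then have "simple_graph B" "isomorphic B \<Gamma>"
        using des by (simp_all add: graph_design_def subgraph_def)
      then show ?thesis using card_Edges_isomorphic[of B \<Gamma>] B(2) by simp
    qed
  qed (rule fin)
  then show ?thesis using un n_subsets[OF assms(1)] inj by (simp add: card_image)
qed

lemma card_Edges_path3: "card (Edges (path_graph 3)) = 2"
proof -
  have "simple_graph (star_on (0::nat) {1, 2})" by (simp add: simple_star_on)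
  moreover have "isomorphic (star_on (0::nat) {1, 2}) (path_graph 3)"
    by (simp add: isomorphic_path3_star_on)
  moreover have "card (Edges (star_on (0::nat) {1, 2})) = 2"
    by (simp add: star_on_def doubleton_eq_iff)
  ultimately show ?thesis using card_Edges_isomorphic by metis
qed

lemma card_Edges_star_graph: "card (Edges (star_graph k)) = k"
proof -
  have "Edges (star_graph k) = (\<lambda>i. {0, i}) ` {1..k}" by (auto simp: star_graph_def)
  moreover have "inj_on (\<lambda>i. {0, i}) {1..k}" by (auto simp: inj_on_def doubleton_eq_iff)
  ultimately show ?thesis by (simp add: card_image)
qed

text \<open>The blocks serve as their own index set. Disjointness of the classes makes the edge set
  through a given edge unique, and injectivity of \<open>Edges\<close> then makes the block
  unique.\<close>

lemma star_design_cover: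
  assumes "graph_design (complete_graph V) (star_graph k) \<B>"
  obtains c L where "star_cover V \<B> c L"
    "\<And>B. B \<in> \<B> \<Longrightarrow> B = star_on (c B) (L B) \<and> finite (L B) \<and> card (L B) = k"
proof -
  have part: "partition_on {e. e \<subseteq> V \<and> card e = 2} (Edges ` \<B>)" and inj: "inj_on Edges \<B>"
    using assms by (simp_all add: graph_design_def complete_graph_def)
  have sub: "subgraph B (complete_graph V)" if "B \<in> \<B>" for B
    using assms that by (simp add: graph_design_def)
  have "\<exists>c L. B = star_on c L \<and> c \<notin> L \<and> finite L \<and> card L = k" if "B \<in> \<B>" for B
    using assms that sub[OF that]
    by (intro isomorphic_star_graphD) (simp_all add: graph_design_def subgraph_def)
  then obtain c L where cL: "\<And>B. B \<in> \<B> \<Longrightarrow>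
      B = star_on (c B) (L B) \<and> c B \<notin> L B \<and> finite (L B) \<and> card (L B) = k"
    by metis
  have Ed: "(\<lambda>l. {c B, l}) ` L B = Edges B" if "B \<in> \<B>" for B
  proof -
    have "Edges (star_on (c B) (L B)) = (\<lambda>l. {c B, l}) ` L B" by (simp add: star_on_def)
    then show ?thesis using cL[OF that] by simp
  qed
  have "star_cover V \<B> c L"
    unfolding star_cover_def
  proof (intro conjI ballI impI)
    fix B assume B: "B \<in> \<B>"
    have "Verts (star_on (c B) (L B)) = insert (c B) (L B)" by (simp add: star_on_def)
    then have "insert (c B) (L B) \<subseteq> V"
      using sub[OF B] cL[OF B] by (simp add: subgraph_def complete_graph_def)
    then show "c B \<in> V" "L B \<subseteq> V - {c B}" using cL[OF B] by auto
  next
    fix a b assume "a \<in> V" "b \<in> V" "a \<noteq> b"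
    then have "{a, b} \<in> {e. e \<subseteq> V \<and> card e = 2}" by simp
    then have "{a, b} \<in> \<Union>(Edges ` \<B>)" using partition_onD1[OF part] by simp
    then obtain B where B: "B \<in> \<B>" "{a, b} \<in> Edges B" by blast
    show "\<exists>!B. B \<in> \<B> \<and> {a, b} \<in> (\<lambda>l. {c B, l}) ` L B"
    proof (rule ex1I[of _ B])
      show "B \<in> \<B> \<and> {a, b} \<in> (\<lambda>l. {c B, l}) ` L B" using B Ed by simp
      fix C assume "C \<in> \<B> \<and> {a, b} \<in> (\<lambda>l. {c C, l}) ` L C"
      then have C: "C \<in> \<B>" "{a, b} \<in> Edges C" using Ed[of C] by simp_all
      have "Edges C = Edges B"
      proof (rule ccontr)
        assume "Edges C \<noteq> Edges B"
        then have "Edges C \<inter> Edges B = {}"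
          using disjointD[OF partition_onD2[OF part]] B(1) C(1) by simp
        then show False using B(2) C(2) by blast
      qed
      then show "C = B" using inj B(1) C(1) by (simp add: inj_on_eq_iff)
    qed
  qed
  then show thesis using cL by (intro that) blast+
qed

section \<open>Star designs with evenly distributed centres\<close>

text \<open>For a small \<open>R\<close> the lower bound on \<open>t\<close> suffices. For a large
  \<open>R\<close> the upper bound is applied to the complement and subtracted from the total; this
  is where \<open>2 * k <= card V\<close> enters.\<close>

lemma landau_condition:
  fixes t :: "'a \<Rightarrow> nat"
  assumes "finite V" "2 * k \<le> card V" "sum t V = card V choose 2"
    and t: "\<And>u. u \<in> V \<Longrightarrow> k * q \<le> t u \<and> t u \<le> k * (q + 1)" and "R \<subseteq> V"
  shows "card R choose 2 \<le> sum t R"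
proof -
  define r where "r = card R"
  have "finite R" using assms(1,5) by (rule finite_subset[rotated])
  have "r * (r - 1) \<le> 2 * sum t R"
  proof (cases "r \<le> 2 * (k * q) + 1")
    \<comment> \<open>Here \<open>(r - 1) / 2 <= k * q\<close>, so the lower bound exceeds the
      average needed per vertex or equals it.\<close>
    case True
    have "r * (k * q) \<le> sum t R"
      using sum_mono[of R "\<lambda>_. k * q" t] t \<open>R \<subseteq> V\<close> by (auto simp: r_def)
    moreover have "r * (r - 1) \<le> r * (2 * (k * q))" using True by (intro mult_left_mono) auto
    moreover have "r * (2 * (k * q)) = 2 * (r * (k * q))" by simp
    ultimately show ?thesis by linarith
  next
    case False
    define d where "d = card (V - R)"
    have v: "card V = r + d"
      using card_Diff_subset[OF \<open>finite R\<close> \<open>R \<subseteq> V\<close>] card_mono[OF assms(1,5)]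
      by (simp add: r_def d_def)
    have "sum t (V - R) \<le> d * (k * (q + 1))"
      using sum_mono[of "V - R" t "\<lambda>_. k * (q + 1)"] t by (simp add: d_def)
    moreover have "sum t V = sum t R + sum t (V - R)"
      using sum.subset_diff[OF assms(5,1), of t] by simp
    moreover have "2 * sum t V = (r + d) * (r + d - 1)"
      using assms(3) double_choose_two[of "r + d"] v by simp
    \<comment> \<open>Ordered pairs in \<open>V\<close> are split into those inside \<open>R\<close>
      and those meeting its complement.\<close>
    moreover have "r * (r - 1) + d * (2 * r + d - 1) = (r + d) * (r + d - 1)"
      using False by (cases r) (simp_all add: algebra_simps)
    \<comment> \<open>From \<open>r >= 2 * k * q + 2\<close> and \<open>r + d >= 2 * k\<close>
      follows \<open>2 * r + d - 1 >= 2 * k * (q + 1)\<close>.\<close>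
    moreover have "d * (2 * (k * (q + 1))) \<le> d * (2 * r + d - 1)"
      using False assms(2) v by (intro mult_left_mono) (auto simp: algebra_simps)
    moreover have "d * (2 * (k * (q + 1))) = 2 * (d * (k * (q + 1)))" by simp
    ultimately show ?thesis by linarith
  qed
  then show ?thesis using double_choose_two[of r] by (simp add: r_def)
qed

text \<open>The second conclusion gives a design in which every vertex is a centre, the extremal
  case that forces \<open>n >= v\<close>.\<close>

theorem star_design_exists:
  assumes "finite V" "card V = v" "0 < k" "2 * k \<le> v" "2 * k dvd v * (v - 1)"
  obtains \<B> where "graph_design (complete_graph V) (star_graph k) \<B>"
    "\<And>u. 2 * k < v \<Longrightarrow> u \<in> V \<Longrightarrow> \<exists>B\<in>\<B>. \<exists>L. B = star_on u L"
proof -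
  obtain b where b: "v * (v - 1) = 2 * k * b" using assms(5) by blast
  then have b2: "v choose 2 = k * b" using double_choose_two[of v] by simp
  define q where "q = b div v"
  have "b mod v \<le> card V" using assms by (simp add: less_imp_le)
  then obtain T where T: "T \<subseteq> V" "card T = b mod v"
    by (metis obtain_subset_with_card_n)
  \<comment> \<open>The \<open>b\<close> stars are shared out as evenly as possible: every vertex is
    to be the centre of \<open>q\<close> of them, and the \<open>b mod v\<close> vertices of
    \<open>T\<close> of one more.\<close>
  define t where "t u = k * (q + of_bool (u \<in> T))" for u
  have "sum t V = k * (\<Sum>u\<in>V. q + of_bool (u \<in> T))"
    by (simp add: t_def sum_distrib_left)
  also have "(\<Sum>u\<in>V. q + of_bool (u \<in> T)) = v * q + card (V \<inter> T)"
    using assms(1,2) by (simp add: sum.distrib sum.If_cases of_bool_def)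
  also have "V \<inter> T = T" using T(1) by blast
  also have "v * q + card T = b" using T(2) by (simp add: q_def)
  finally have total: "sum t V = v choose 2" using b2 by simp
  let ?K = "{e. e \<subseteq> V \<and> card e = 2}"
  have finK: "finite ?K" using assms(1) by simp
  have "\<exists>g. orients ?K g \<and> (\<forall>u\<in>V. outdeg ?K g u = t u)"
  proof (rule orientation_with_outdegrees[OF assms(1)])
    show "card ?K = sum t V" using n_subsets[OF assms(1)] total assms(2) by simp
    fix R assume R: "R \<subseteq> V"
    have "{e \<in> ?K. e \<subseteq> R} = {e. e \<subseteq> R \<and> card e = 2}" using R by blast
    moreover have "finite R" using assms(1) R by (rule finite_subset[rotated])
    moreover have "card R choose 2 \<le> sum t R"
      by (rule landau_condition[OF assms(1) _ _ _ R, of k _ q])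
        (use assms(2,4) total in \<open>auto simp: t_def\<close>)
    ultimately show "card {e \<in> ?K. e \<subseteq> R} \<le> sum t R" by (simp add: n_subsets)
  qed simp
  then obtain g where g: "orients ?K g" "\<And>u. u \<in> V \<Longrightarrow> outdeg ?K g u = t u" by blast
  have "k dvd outdeg ?K g u" for u
  proof (cases "u \<in> V")
    case True
    then show ?thesis by (simp add: g(2) t_def)
  next
    case False
    then have "{e \<in> ?K. g e = u} = {}" using g(1) by (auto simp: orients_def)
    then show ?thesis by (simp only: outdeg_def card.empty dvd_0_right)
  qed
  from star_partition[OF finK _ g(1) \<open>0 < k\<close> this]
  obtain \<B> where \<B>: "\<forall>B\<in>\<B>. \<exists>c L. B = star_on c L \<and> c \<notin> L \<and> finite L \<and> card L = k \<and>
      (\<forall>e\<in>Edges B. g e = c)"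
    and part: "partition_on ?K (Edges ` \<B>)"
    by auto
  have "2 \<le> card V" using assms by simp
  then obtain e where "e \<subseteq> V" "card e = 2" by (metis obtain_subset_with_card_n)
  then have "?K \<noteq> {}" by blast
  then have "\<B> \<noteq> {}" using part by (auto simp: partition_on_def)
  have "graph_design (complete_graph V) (star_graph k) \<B>"
  proof (rule graph_design_of_stars[OF assms(1,3) \<open>\<B> \<noteq> {}\<close> _ part])
    show "\<exists>c L. B = star_on c L \<and> c \<notin> L \<and> finite L \<and> card L = k" if "B \<in> \<B>" for B
      using \<B> that by blast
  qed (simp add: isomorphic_star_on)
  moreover have "\<exists>B\<in>\<B>. \<exists>L. B = star_on u L" if "2 * k < v" and u: "u \<in> V" for u
  proof -
    \<comment> \<open>If \<open>v > 2 * k\<close>, there are at least as many stars as vertices, so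
      \<open>q\<close> is positive and no vertex is left without a star.\<close>
    have "2 * k * v \<le> v * (v - 1)" using that(1) by (simp add: mult.commute)
    then have "2 * k * v \<le> 2 * k * b" by (simp only: b)
    then have "v \<le> b" using \<open>0 < k\<close> by simp
    then have "0 < q" using that(1) by (simp add: q_def div_greater_zero_iff)
    then have "outdeg ?K g u \<noteq> 0" using g(2)[OF u] \<open>0 < k\<close> by (simp add: t_def)
    then have "{e \<in> ?K. g e = u} \<noteq> {}" unfolding outdeg_def by (metis card.empty)
    then obtain e where e: "e \<in> ?K" "g e = u" by blast
    then have "e \<in> \<Union>(Edges ` \<B>)" using partition_onD1[OF part] by simp
    then obtain B where B: "B \<in> \<B>" "e \<in> Edges B" by blast
    then obtain c L where "B = star_on c L" "g e = c" using \<B> by blast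
    then show ?thesis using B(1) e(2) by blast
  qed
  ultimately show thesis by (rule that)
qed

section \<open>Down-links and the two inclusions\<close>

text \<open>The image of a star has an edge, and every edge of a star contains the centre.\<close>

lemma centre_in_down_link:
  assumes "graph_design (complete_graph W) \<Gamma> \<B>'" "down_link \<B> \<B>' f"
    and "star_on u L \<in> \<B>"
  shows "u \<in> W"
proof -
  let ?P = "f (star_on u L)"
  have P: "?P \<in> \<B>'" "subgraph ?P (star_on u L)"
    using assms(2,3) by (simp_all add: down_link_def)
  have "Edges ?P \<noteq> {}" using assms(1) P(1) by (auto simp: graph_design_def partition_on_def)
  then obtain e where e: "e \<in> Edges ?P" by blast
  have "subgraph ?P (complete_graph W)" using assms(1) P(1) by (simp add: graph_design_def)
  then have "e \<subseteq> W" using e by (auto simp: subgraph_def complete_graph_def)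
  moreover have "e \<in> Edges (star_on u L)" using e P(2) by (auto simp: subgraph_def)
  then have "u \<in> e" by (auto simp: star_on_def)
  ultimately show ?thesis by blast
qed

text \<open>The paths are chosen in the stars with leaf sets \<open>M B\<close>, inside the blocks:
  \<open>M\<close> is \<open>L\<close> itself if \<open>n >= v\<close>, and \<open>L\<close> without
  the deleted vertex if \<open>n = v - 1\<close>.\<close>

lemma down_link_to_path_design:
  assumes "finite W" "even (card W choose 2)" "V \<subseteq> W" "\<B> \<noteq> {}"
    and cov: "star_cover V \<B> c M"
    and M: "\<And>B. B \<in> \<B> \<Longrightarrow> 4 \<le> card (M B) \<and> M B \<subseteq> L B"
    and B: "\<And>B. B \<in> \<B> \<Longrightarrow> B = star_on (c B) (L B) \<and> simple_graph B"
  shows "\<exists>\<B>' f. design_of_order (card W) (path_graph 3) \<B>' \<and> down_link \<B> \<B>' f"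
proof -
  obtain \<P> S where \<P>: "graph_design (complete_graph W) (path_graph 3) \<P>"
    "\<forall>B\<in>\<B>. S B \<subseteq> M B \<and> star_on (c B) (S B) \<in> \<P>"
    using path_design_through_stars[OF assms(1,3) cov _ assms(4,2)] M by blast
  let ?f = "\<lambda>B. star_on (c B) (S B)"
  have "subgraph (?f B) B" if "B \<in> \<B>" for B
  proof -
    have "?f B \<in> \<P>" "S B \<subseteq> L B" using \<P>(2) M that by blast+
    then have "simple_graph (?f B)" using \<P>(1) by (simp add: graph_design_def subgraph_def)
    moreover have "Verts (?f B) \<subseteq> Verts (star_on (c B) (L B))"
      "Edges (?f B) \<subseteq> Edges (star_on (c B) (L B))"
      using \<open>S B \<subseteq> L B\<close> by (auto simp: star_on_def)
    ultimately show ?thesis using B[OF that] by (simp add: subgraph_def)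
  qed
  then have "down_link \<B> \<P> ?f" using \<P>(2) by (simp add: down_link_def)
  moreover have "design_of_order (card W) (path_graph 3) \<P>"
    unfolding design_of_order_def using assms(1) \<P>(1) by blast
  ultimately show ?thesis by blast
qed

text \<open>All three conditions are read off from a down-link of one design, the one built in
  \<open>star_design_exists\<close>.\<close>

lemma L2_subset:
  assumes "0 < k" "2 * k \<le> v" "2 * k dvd v * (v - 1)"
    and n: "n \<in> L2 TYPE('a::infinite) (star_graph k) v"
  shows "even (n choose 2)" "v - 1 \<le> n" "2 * k < v \<Longrightarrow> v \<le> n"
proof -
  obtain V :: "'a set" where V: "finite V" "card V = v"
    using infinite_arbitrarily_large[OF infinite_UNIV] by blast
  obtain \<B> where \<B>: "graph_design (complete_graph V) (star_graph k) \<B>"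
    and centres: "\<And>u. 2 * k < v \<Longrightarrow> u \<in> V \<Longrightarrow> \<exists>B\<in>\<B>. \<exists>L. B = star_on u L"
    using star_design_exists[OF V assms(1-3)] by blast
  have "design_of_order v (star_graph k) \<B>"
    unfolding design_of_order_def using V \<B> by blast
  then obtain \<B>' f where "design_of_order n (path_graph 3) \<B>'" and f: "down_link \<B> \<B>' f"
    using n unfolding L2_def by blast
  then obtain W where W: "finite W" "card W = n"
    and \<B>': "graph_design (complete_graph W) (path_graph 3) \<B>'"
    unfolding design_of_order_def by blast
  show "even (n choose 2)"
    using card_graph_design[OF W(1) \<B>'] W(2) card_Edges_path3 by (metis dvd_triv_left)
  show "v \<le> n" if "2 * k < v"
  proof -
    have "V \<subseteq> W" using centres[OF that] centre_in_down_link[OF \<B>' f] by blast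
    then show ?thesis using card_mono[OF W(1) \<open>V \<subseteq> W\<close>] V(2) W(2) by simp
  qed
  obtain c L where cov: "star_cover V \<B> c L"
    and cL: "\<And>B. B \<in> \<B> \<Longrightarrow> B = star_on (c B) (L B) \<and> finite (L B) \<and> card (L B) = k"
    using star_design_cover[OF \<B>] by blast
  \<comment> \<open>The star covering an edge \<open>{a, b}\<close> has its centre at
    \<open>a\<close> or \<open>b\<close>, but all centres lie in \<open>W\<close>.\<close>
  have "a = b" if ab: "a \<in> V - W" "b \<in> V - W" for a b
  proof (rule ccontr)
    assume "a \<noteq> b"
    then obtain B where B: "B \<in> \<B>" "{a, b} \<in> (\<lambda>l. {c B, l}) ` L B"
      using ab cov unfolding star_cover_def by blast
    then have "c B \<in> {a, b}" by blast
    moreover have "star_on (c B) (L B) \<in> \<B>" using B(1) cL by simp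
    then have "c B \<in> W" by (rule centre_in_down_link[OF \<B>' f])
    ultimately show False using ab by blast
  qed
  then have "card (V - W) \<le> 1" using V(1) by (simp add: card_le_Suc0_iff_eq)
  moreover have "card V - card W \<le> card (V - W)" using W(1) by (rule diff_card_le_card_Diff)
  ultimately show "v - 1 \<le> n" using V(2) W(2) by simp
qed

lemma L2_superset:
  assumes "3 < k" "2 * k \<le> v" "even (n choose 2)"
    and n: "v \<le> n \<or> v = 2 * k \<and> n = v - 1"
  shows "n \<in> L2 TYPE('a::infinite) (star_graph k) v"
  unfolding L2_def
proof (intro CollectI allI impI)
  fix \<B> :: "'a sgraph set"
  assume "design_of_order v (star_graph k) \<B>"
  then obtain V where V: "finite V" "card V = v"
    and \<B>: "graph_design (complete_graph V) (star_graph k) \<B>"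
    unfolding design_of_order_def by blast
  obtain c L where cov: "star_cover V \<B> c L"
    and cL: "\<And>B. B \<in> \<B> \<Longrightarrow> B = star_on (c B) (L B) \<and> finite (L B) \<and> card (L B) = k"
    using star_design_cover[OF \<B>] by blast
  have blocks: "k * card \<B> = v choose 2"
    using card_graph_design[OF V(1) \<B>] V(2) by (simp add: card_Edges_star_graph)
  moreover have "v choose 2 > 0" using assms(1,2) by (simp add: zero_less_binomial_iff)
  ultimately have "card \<B> \<noteq> 0" by (metis mult_0_right less_numeral_extra(3))
  then have "\<B> \<noteq> {}" "finite \<B>" by (simp_all add: card_eq_0_iff)
  have simple: "B = star_on (c B) (L B) \<and> simple_graph B" if "B \<in> \<B>" for B
    using cL[OF that] \<B> that by (simp add: graph_design_def subgraph_def)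
  show "\<exists>\<B>' f. design_of_order n (path_graph 3) \<B>' \<and> down_link \<B> \<B>' f"
  proof (cases "v \<le> n")
    case True
    \<comment> \<open>The infinite universe supplies \<open>n - v\<close> new vertices, so that
      \<open>W\<close> contains \<open>V\<close>.\<close>
    have "infinite (UNIV - V)" using V(1) infinite_UNIV by (rule Diff_infinite_finite)
    then obtain U where U: "finite U" "card U = n - v" "U \<subseteq> UNIV - V"
      using infinite_arbitrarily_large by blast
    then have W: "finite (V \<union> U)" "card (V \<union> U) = n"
      using V True card_Un_disjoint[of V U] by auto
    have M: "4 \<le> card (L B) \<and> L B \<subseteq> L B" if "B \<in> \<B>" for B
      using cL[OF that] assms(1) by simp
    show ?thesis
      using down_link_to_path_design[OF W(1) _ _ \<open>\<B> \<noteq> {}\<close> cov M simple] W(2) assms(3) by simp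
  next
    case False
    then have vn: "v = 2 * k" "n = 2 * k - 1" using n by auto
    \<comment> \<open>There are only \<open>2 * k - 1\<close> stars for \<open>2 * k\<close>
      vertices, so some vertex is not a centre and can be deleted.\<close>
    have "k * card \<B> = k * (2 * k - 1)"
      using blocks double_choose_two[of v] vn(1) by simp
    then have "card \<B> = 2 * k - 1" using assms(1) by simp
    then have "card (c ` \<B>) < card V"
      using card_image_le[OF \<open>finite \<B>\<close>, of c] V(2) vn(1) assms(1) by simp
    then have "\<not> V \<subseteq> c ` \<B>" using card_mono[of "c ` \<B>" V] \<open>finite \<B>\<close> by auto
    then obtain x where x: "x \<in> V" "x \<notin> c ` \<B>" by blast
    have W: "finite (V - {x})" "card (V - {x}) = n" using V x(1) vn by simp_all
    \<comment> \<open>An even \<open>k\<close> would give \<open>n = 2 * k - 1\<close> the residue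
      \<open>3\<close> modulo \<open>4\<close>. Hence \<open>k >= 5\<close>, and four leaves survive
      the deletion of \<open>x\<close>.\<close>
    have "odd k"
    proof
      assume "even k"
      then obtain j where "k = 2 * j" by (rule evenE)
      then have "n = 3 + 4 * (j - 1)" using vn(2) assms(1) by simp
      then have "n mod 4 = 3" by simp
      then show False
        using assms(3) unfolding even_choose_two_iff by (simp add: cong_def)
    qed
    then have "4 < k" using assms(1) by (cases "k = 4") auto
    have M: "4 \<le> card (L B - {x}) \<and> L B - {x} \<subseteq> L B" if "B \<in> \<B>" for B
      using diff_card_le_card_Diff[of "{x}" "L B"] cL[OF that] \<open>4 < k\<close> by auto
    show ?thesis
      using down_link_to_path_design[OF W(1) _ subset_refl \<open>\<B> \<noteq> {}\<close>
          star_cover_delete_vertex[OF cov x(2)] M simple] W(2) assms(3) by simp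
  qed
qed

theorem theorem5p4:
  fixes k :: nat
  assumes "k > 3"
  shows "L2 TYPE('a::infinite) (star_graph k) (2 * k) =
           {n. n \<ge> 2 * k - 1 \<and> ([n = 0] (mod 4) \<or> [n = 1] (mod 4))}
       \<and> (\<forall>v > 2 * k. [v * (v - 1) = 0] (mod (2 * k)) \<longrightarrow>
           L2 TYPE('a) (star_graph k) v =
             {n. n \<ge> v \<and> ([n = 0] (mod 4) \<or> [n = 1] (mod 4))})"
proof (intro conjI allI impI)
  show "L2 TYPE('a) (star_graph k) (2 * k) =
      {n. n \<ge> 2 * k - 1 \<and> ([n = 0] (mod 4) \<or> [n = 1] (mod 4))}"
  \<comment> \<open>The congruences are replaced by evenness of the number of edges, the form used
    in both inclusions.\<close>
  proof (intro equalityI subsetI CollectI; unfold even_choose_two_iff[symmetric])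
    fix n assume n: "n \<in> L2 TYPE('a) (star_graph k) (2 * k)"
    show "2 * k - 1 \<le> n \<and> even (n choose 2)"
      using L2_subset(1,2)[OF _ _ _ n] assms by simp
  next
    fix n assume "n \<in> {n. 2 * k - 1 \<le> n \<and> even (n choose 2)}"
    then show "n \<in> L2 TYPE('a) (star_graph k) (2 * k)"
      using assms by (intro L2_superset) auto
  qed
next
  fix v assume v: "2 * k < v" "[v * (v - 1) = 0] (mod (2 * k))"
  show "L2 TYPE('a) (star_graph k) v =
      {n. n \<ge> v \<and> ([n = 0] (mod 4) \<or> [n = 1] (mod 4))}"
  proof (intro equalityI subsetI CollectI; unfold even_choose_two_iff[symmetric])
    fix n assume n: "n \<in> L2 TYPE('a) (star_graph k) v"
    show "v \<le> n \<and> even (n choose 2)"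
      using L2_subset(1,3)[OF _ _ _ n] assms v by (simp add: cong_0_iff)
  next
    fix n assume "n \<in> {n. v \<le> n \<and> even (n choose 2)}"
    then show "n \<in> L2 TYPE('a) (star_graph k) v"
      using assms v by (intro L2_superset) auto
  qed
qed

end
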